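(* Let $x_1,\dots,x_n\in\mathbb{R}^{d+1}$ be demand points (each with $0$-th coordinate equal to $1$), let $\lambda\in\mathbb{R}^n_+$, let $p=\frac{r}{s}\in\mathbb{Q}$ with $r,s$ positive integers, and let $\|\cdot\|$ be a norm on $\mathbb{R}^d$ with dual norm $\|\cdot\|^*$. Then, for every sufficiently large constant $M>0$ (depending on the data), the fitting hyperplane problem $$\min_{\beta}\ \sum_{i=1}^n\lambda_i\,\varepsilon_{(i)}(\beta)^p$$ with residuals $\varepsilon_{x_i}(\beta)=\min_{y\in\mathcal H(\beta)}\|(x_i)_{-0}-y\|$ is equivalent to the following mathematical programming problem in the variables $\beta\in\mathbb{R}^{d+1}$ (with $\beta_{-0}\neq 0$), $\varepsilon\in\mathbb{R}^n$, $z,\theta\in\mathbb{R}^n_+$ and $w\in\{0,1\}^{n\times n}$: $$\begin{aligned} \min\ & \sum_{j=1}^n\lambda_j\theta_j\\ \text{s.t. } & \varepsilon_i\ \ge\ \frac{|\beta^t x_i|}{\|\beta_{-0}\|^*}, && i=1,\dots,n,\\ & z_i\le\theta_j+M(1-w_{ij}), && i,j=1,\dots,n,\\ & z_i^s\ge\varepsilon_i^r, && i=1,\dots,n,\\ & \sum_{i=1}^n w_{ij}=1, && j=1,\dots,n,\\ & \sum_{j=1}^n w_{ij}=1, && i=1,\dots,n,\\ & \theta_j\ge\theta_{j-1}, && j=2,\dots,n. \end{aligned}$$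
   Context: Vectors in $\mathbb{R}^{d+1}$ are indexed $0,1,\dots,d$; for $y\in\mathbb{R}^{d+1}$, $y_{-0}=(y_1,\dots,y_d)$. Demand points $x\in\mathbb{R}^{d+1}$ have $0$-th coordinate $1$, the actual point in $\mathbb{R}^d$ being $x_{-0}$. For $\beta\in\mathbb{R}^{d+1}$ with $\beta_{-0}\ne0$, $\mathcal H(\beta)=\{y\in\mathbb{R}^d:\ (1,y^t)\beta=0\}$. The dual norm is $\|u\|^*=\max_{\|v\|\le1}u^tv$. For residuals $\varepsilon_{x_1}(\beta),\dots,\varepsilon_{x_n}(\beta)$, $\varepsilon_{(1)}(\beta)\le\dots\le\varepsilon_{(n)}(\beta)$ denotes the same values sorted in nondecreasing order. "Equivalent" means: both problems have the same optimal value, and $\beta$ is optimal for the fitting hyperplane problem if and only if it is the $\beta$-component of an optimal solution of the mathematical program. *)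

theory Defs
  imports "HOL-Analysis.Analysis"
begin

text \<open>
  A vector of \<open>\<real>\<^sup>d\<^sup>+\<^sup>1\<close> with coordinates indexed by \<open>0, \<dots>, d\<close> is an element \<open>b\<close> of
  \<^typ>\<open>real \<times> (real ^ 'd)\<close>: the \<open>0\<close>-th coordinate is \<^term>\<open>fst b\<close>, the vector of the remaining
  ones is \<^term>\<open>snd b\<close>, and \<open>\<bullet>\<close> on the product type is the usual scalar product.
\<close>

definition is_norm :: "('a::real_vector \<Rightarrow> real) \<Rightarrow> bool" where
  "is_norm N \<longleftrightarrow> (\<forall>v. 0 \<le> N v) \<and> (\<forall>v. N v = 0 \<longleftrightarrow> v = 0) \<and>
     (\<forall>c v. N (c *\<^sub>R v) = \<bar>c\<bar> * N v) \<and> (\<forall>u v. N (u + v) \<le> N u + N v)"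

text \<open>
  The supremum in \<open>dual_norm\<close> and the infimum in \<open>residual\<close> are attained; see
  \<open>dual_norm_is_max\<close> and \<open>residual_is_min\<close> below.
\<close>

definition dual_norm :: "(real ^ 'd \<Rightarrow> real) \<Rightarrow> real ^ 'd \<Rightarrow> real" where
  "dual_norm N u = (SUP v\<in>{v. N v \<le> 1}. u \<bullet> v)"

definition hyperplane :: "real \<times> (real ^ 'd) \<Rightarrow> (real ^ 'd) set" where
  "hyperplane b = {y. (1, y) \<bullet> b = 0}"

definition residual :: "(real ^ 'd \<Rightarrow> real) \<Rightarrow> real \<times> (real ^ 'd) \<Rightarrow> real \<times> (real ^ 'd) \<Rightarrow> real" where
  "residual N x b = (INF y\<in>hyperplane b. N (snd x - y))"

definition sorted_residual ::
  "(real ^ 'd \<Rightarrow> real) \<Rightarrow> nat \<Rightarrow> (nat \<Rightarrow> real \<times> (real ^ 'd)) \<Rightarrow> real \<times> (real ^ 'd) \<Rightarrow> nat \<Rightarrow> real" where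
  "sorted_residual N n x b i = sort (map (\<lambda>k. residual N (x k) b) [1..<n + 1]) ! (i - 1)"

definition fitting_feasible :: "(real \<times> (real ^ 'd)) set" where
  "fitting_feasible = {b. snd b \<noteq> 0}"

definition fitting_objective ::
  "(real ^ 'd \<Rightarrow> real) \<Rightarrow> nat \<Rightarrow> (nat \<Rightarrow> real \<times> (real ^ 'd)) \<Rightarrow> (nat \<Rightarrow> real) \<Rightarrow> real \<Rightarrow>
     real \<times> (real ^ 'd) \<Rightarrow> real" where
  "fitting_objective N n x l p b = (\<Sum>i=1..n. l i * sorted_residual N n x b i powr p)"

text \<open>
  Vectors of \<open>\<real>\<^sup>n\<close> and \<open>n \<times> n\<close> matrices are functions on \<^typ>\<open>nat\<close> of which only the
  values at the indices \<open>1, \<dots>, n\<close> matter.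
\<close>

type_synonym 'd mp_point =
  "(real \<times> (real ^ 'd)) \<times> (nat \<Rightarrow> real) \<times> (nat \<Rightarrow> real) \<times> (nat \<Rightarrow> real) \<times> (nat \<Rightarrow> nat \<Rightarrow> real)"

definition mp_feasible ::
  "(real ^ 'd \<Rightarrow> real) \<Rightarrow> nat \<Rightarrow> (nat \<Rightarrow> real \<times> (real ^ 'd)) \<Rightarrow> nat \<Rightarrow> nat \<Rightarrow> real \<Rightarrow>
     'd mp_point set" where
  "mp_feasible N n x r s M = {(b, e, z, t, w).
     snd b \<noteq> 0 \<and>
     (\<forall>i\<in>{1..n}. 0 \<le> z i) \<and>
     (\<forall>j\<in>{1..n}. 0 \<le> t j) \<and>
     (\<forall>i\<in>{1..n}. \<forall>j\<in>{1..n}. w i j \<in> {0, 1}) \<and>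
     (\<forall>i\<in>{1..n}. e i \<ge> \<bar>b \<bullet> x i\<bar> / dual_norm N (snd b)) \<and>
     (\<forall>i\<in>{1..n}. \<forall>j\<in>{1..n}. z i \<le> t j + M * (1 - w i j)) \<and>
     (\<forall>i\<in>{1..n}. z i ^ s \<ge> e i ^ r) \<and>
     (\<forall>j\<in>{1..n}. (\<Sum>i=1..n. w i j) = 1) \<and>
     (\<forall>i\<in>{1..n}. (\<Sum>j=1..n. w i j) = 1) \<and>
     (\<forall>j\<in>{2..n}. t j \<ge> t (j - 1))}"

definition mp_objective :: "nat \<Rightarrow> (nat \<Rightarrow> real) \<Rightarrow> 'd mp_point \<Rightarrow> real" where
  "mp_objective n l = (\<lambda>(b, e, z, t, w). \<Sum>j=1..n. l j * t j)"

definition optimal_value :: "'a set \<Rightarrow> ('a \<Rightarrow> real) \<Rightarrow> ereal" where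
  "optimal_value S f = (INF a\<in>S. ereal (f a))"

definition optimal_solution :: "'a set \<Rightarrow> ('a \<Rightarrow> real) \<Rightarrow> 'a \<Rightarrow> bool" where
  "optimal_solution S f a \<longleftrightarrow> is_arg_min f (\<lambda>a. a \<in> S) a"

definition equivalent_problems ::
  "'a set \<Rightarrow> ('a \<Rightarrow> real) \<Rightarrow> 'b set \<Rightarrow> ('b \<Rightarrow> real) \<Rightarrow> ('b \<Rightarrow> 'a) \<Rightarrow> bool" where
  "equivalent_problems S f T g \<pi> \<longleftrightarrow>
     optimal_value S f = optimal_value T g \<and>
     (\<forall>a. optimal_solution S f a \<longleftrightarrow> (\<exists>t. optimal_solution T g t \<and> \<pi> t = a))"


lemma is_norm_continuous:
  fixes N :: "real ^ 'd \<Rightarrow> real"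
  assumes "is_norm N"
  shows "continuous_on UNIV N"
proof (rule convex_on_continuous)
  show "convex_on UNIV N"
  proof (rule convex_onI)
    fix t :: real and u v :: "real ^ 'd"
    assume "0 < t" "t < 1"
    moreover have "N ((1 - t) *\<^sub>R u + t *\<^sub>R v) \<le> N ((1 - t) *\<^sub>R u) + N (t *\<^sub>R v)"
      using assms unfolding is_norm_def by blast
    moreover have "N (c *\<^sub>R v) = \<bar>c\<bar> * N v" for c v
      using assms by (simp add: is_norm_def)
    ultimately show "N ((1 - t) *\<^sub>R u + t *\<^sub>R v) \<le> (1 - t) * N u + t * N v"
      by simp
  qed simp
qed simp

lemma is_norm_compact_ball:
  fixes N :: "real ^ 'd \<Rightarrow> real"
  assumes "is_norm N"
  shows "compact {v. N v \<le> 1}"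
proof -
  have N: "0 \<le> N v" "N v = 0 \<longleftrightarrow> v = 0" "N (c *\<^sub>R v) = \<bar>c\<bar> * N v" for c v
    using assms by (auto simp: is_norm_def)
  have cont: "continuous_on A N" for A
    using is_norm_continuous[OF assms] continuous_on_subset by blast
  have "sphere (0 :: real ^ 'd) 1 \<noteq> {}"
    by simp
  then obtain a where a: "a \<in> sphere 0 1" "\<And>v. v \<in> sphere 0 1 \<Longrightarrow> N a \<le> N v"
    using continuous_attains_inf[OF compact_sphere _ cont] by metis
  then have "N a > 0"
    using N(1)[of a] N(2)[of a] by (auto simp: order.order_iff_strict)
  have "norm v \<le> 1 / N a" if "N v \<le> 1" for v
  proof (cases "v = 0")
    case True
    then show ?thesis using \<open>N a > 0\<close> by simp
  next
    case False
    then have "N a \<le> N ((1 / norm v) *\<^sub>R v)"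
      by (intro a) simp
    then have "norm v * N a \<le> N v"
      using False by (simp add: N(3) field_simps)
    then show ?thesis
      using \<open>N a > 0\<close> that by (simp add: field_simps)
  qed
  then have "bounded {v. N v \<le> 1}"
    by (auto simp: bounded_iff)
  moreover have "closed {v. N v \<le> 1}"
    using closed_Collect_le[OF cont continuous_on_const] by simp
  ultimately show ?thesis
    by (simp add: compact_eq_bounded_closed)
qed

lemma dual_norm_is_max:
  assumes "is_norm N"
  shows "\<exists>v. N v \<le> 1 \<and> u \<bullet> v = dual_norm N u"
    and "N v \<le> 1 \<Longrightarrow> u \<bullet> v \<le> dual_norm N u"
proof -
  have "N 0 = 0"
    using assms unfolding is_norm_def by blast
  then have ne: "{v. N v \<le> 1} \<noteq> {}"
    by (auto intro: exI[of _ 0])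
  have "continuous_on {v. N v \<le> 1} (\<lambda>v. u \<bullet> v)"
    by (intro continuous_intros)
  then obtain a where a: "N a \<le> 1" "\<And>v. N v \<le> 1 \<Longrightarrow> u \<bullet> v \<le> u \<bullet> a"
    using continuous_attains_sup[OF is_norm_compact_ball[OF assms] ne] by blast
  then have "dual_norm N u = u \<bullet> a"
    unfolding dual_norm_def by (intro cSup_eq_maximum) auto
  with a show "\<exists>v. N v \<le> 1 \<and> u \<bullet> v = dual_norm N u"
    and "N v \<le> 1 \<Longrightarrow> u \<bullet> v \<le> dual_norm N u"
    by auto
qed

lemma residual_is_min:
  assumes "is_norm N" and "snd b \<noteq> 0"
  shows "\<exists>y\<in>hyperplane b. N (snd x - y) = residual N x b"
    and "y \<in> hyperplane b \<Longrightarrow> residual N x b \<le> N (snd x - y)"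
proof -
  have "closed (hyperplane b)"
    unfolding hyperplane_def by (intro closed_Collect_eq continuous_intros)
  define y0 where "y0 = - (fst b / (snd b \<bullet> snd b)) *\<^sub>R snd b"
  have y0: "y0 \<in> hyperplane b"
    using assms(2) by (simp add: hyperplane_def inner_prod_def y0_def)
  define R where "R = N (snd x - y0) + 1"
  have N: "0 \<le> N v" "N (c *\<^sub>R v) = \<bar>c\<bar> * N v" for c v
    using assms by (auto simp: is_norm_def)
  have R: "R > 0" "N (snd x - y0) \<le> R"
    using N(1)[of "snd x - y0"] by (auto simp: R_def)
  have ball: "compact ((\<lambda>v. snd x - R *\<^sub>R v) ` {v. N v \<le> 1})"
    by (intro compact_continuous_image is_norm_compact_ball assms continuous_intros)
  let ?K = "hyperplane b \<inter> (\<lambda>v. snd x - R *\<^sub>R v) ` {v. N v \<le> 1}"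
  have mem: "y \<in> (\<lambda>v. snd x - R *\<^sub>R v) ` {v. N v \<le> 1}" if "N (snd x - y) \<le> R" for y
  proof (rule image_eqI)
    show "y = snd x - R *\<^sub>R ((1 / R) *\<^sub>R (snd x - y))"
      using R by simp
    show "(1 / R) *\<^sub>R (snd x - y) \<in> {v. N v \<le> 1}"
      using R that by (simp add: N(2) del: scaleR_right_diff_distrib)
  qed
  have "continuous_on ?K (\<lambda>y. N (snd x - y))"
    by (rule continuous_on_compose2[OF is_norm_continuous[OF assms(1)]])
       (auto intro!: continuous_intros)
  moreover have "compact ?K"
    using \<open>closed (hyperplane b)\<close> ball by (rule closed_Int_compact)
  moreover have "?K \<noteq> {}"
    using y0 mem R by blast
  ultimately obtain a where a: "a \<in> ?K" "\<And>y. y \<in> ?K \<Longrightarrow> N (snd x - a) \<le> N (snd x - y)"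
    using continuous_attains_inf by metis
  have min: "N (snd x - a) \<le> N (snd x - y)" if "y \<in> hyperplane b" for y
  proof (cases "N (snd x - y) \<le> R")
    case True
    then show ?thesis using a mem that by blast
  next
    case False
    then show ?thesis using a(2)[of y0] y0 mem R by force
  qed
  then have "residual N x b = N (snd x - a)"
    unfolding residual_def using a by (intro cInf_eq_minimum) auto
  then show "\<exists>y\<in>hyperplane b. N (snd x - y) = residual N x b"
    and "y \<in> hyperplane b \<Longrightarrow> residual N x b \<le> N (snd x - y)"
    using a min by auto
qed

end

theory Submission
  imports Defs
begin

text \<open>
  The distance formula identifies the right-hand side of the first constraint with the residual.
  The columns of a feasible \<open>w\<close> pick out distinct rows, so \<open>\<theta>\<^sub>1 \<le> \<dots> \<le> \<theta>\<^sub>j\<close> dominate the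
  \<open>p\<close>-th powers of \<open>j\<close> different residuals, whence \<open>\<theta>\<^sub>j \<ge> \<epsilon>\<^sub>(\<^sub>j\<^sub>)\<^sup>p\<close> by the pigeonhole principle.
  Conversely a hyperplane \<open>\<beta>\<close> lifts to a feasible point with \<open>\<theta>\<^sub>j = \<epsilon>\<^sub>(\<^sub>j\<^sub>)\<^sup>p\<close> once \<open>M\<close> exceeds
  all \<open>\<epsilon>\<^sub>i\<^sup>p\<close>. In general no \<open>M\<close> does so for every \<open>\<beta>\<close>, but only those on a sublevel set of the
  objective matter: there some \<open>\<epsilon>\<^sub>(\<^sub>j\<^sub>)\<close> with \<open>\<lambda>\<^sub>j > 0\<close> is bounded, hence so are all residuals, as
  two of them differ by at most the distance of the two demand points. If \<open>\<lambda> = 0\<close>, a large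
  constant \<open>\<theta>\<close> works for every \<open>M\<close>.
\<close>

section \<open>Equivalence from projecting and lifting feasible points\<close>

text \<open>Lifts are required only below the level of a reference point \<open>a0\<close>, so that
  the big-M constant need not serve all of \<open>S\<close>. Points above that level are harmless:
  the lift of \<open>a0\<close> already has a smaller value.\<close>

lemma equivalent_problemsI:
  assumes proj: "\<And>t. t \<in> T \<Longrightarrow> \<pi> t \<in> S \<and> f (\<pi> t) \<le> g t"
    and "a0 \<in> S"
    and lift: "\<And>a. a \<in> S \<Longrightarrow> f a \<le> f a0 \<Longrightarrow> \<exists>t\<in>T. \<pi> t = a \<and> g t \<le> f a"
  shows "equivalent_problems S f T g \<pi>"
proof -
  have dom: "\<exists>t\<in>T. g t \<le> f a" if "a \<in> S" for a
    using lift[OF that] lift[OF \<open>a0 \<in> S\<close>] by (cases "f a \<le> f a0") force+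
  have "optimal_value S f = optimal_value T g"
    unfolding optimal_value_def
  proof (rule antisym)
    show "(INF a\<in>S. ereal (f a)) \<le> (INF t\<in>T. ereal (g t))"
      by (rule INF_mono) (use proj in force)
    show "(INF t\<in>T. ereal (g t)) \<le> (INF a\<in>S. ereal (f a))"
      by (rule INF_mono) (use dom in force)
  qed
  moreover have "optimal_solution S f a \<longleftrightarrow> (\<exists>t. optimal_solution T g t \<and> \<pi> t = a)" for a
  proof
    assume "optimal_solution S f a"
    then have a: "a \<in> S" "\<And>a'. a' \<in> S \<Longrightarrow> f a \<le> f a'"
      by (auto simp: optimal_solution_def is_arg_min_linorder)
    then obtain t where t: "t \<in> T" "\<pi> t = a" "g t \<le> f a"
      using lift \<open>a0 \<in> S\<close> by blast
    moreover have "g t \<le> g t'" if "t' \<in> T" for t'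
      using t(3) a(2) proj[OF that] by fastforce
    ultimately show "\<exists>t. optimal_solution T g t \<and> \<pi> t = a"
      by (auto simp: optimal_solution_def is_arg_min_linorder)
  next
    assume "\<exists>t. optimal_solution T g t \<and> \<pi> t = a"
    then obtain t where t: "t \<in> T" "\<pi> t = a" "\<And>t'. t' \<in> T \<Longrightarrow> g t \<le> g t'"
      by (auto simp: optimal_solution_def is_arg_min_linorder)
    have "f a \<le> f a'" if "a' \<in> S" for a'
      using dom[OF that] t proj[OF t(1)] by force
    then show "optimal_solution S f a"
      using proj[OF t(1)] t(2) by (auto simp: optimal_solution_def is_arg_min_linorder)
  qed
  ultimately show ?thesis
    by (simp add: equivalent_problems_def)
qed

section \<open>Distance from a point to a hyperplane in an arbitrary norm\<close>

lemma dual_norm_pos: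
  assumes "is_norm N" and "u \<noteq> 0"
  shows "dual_norm N u > 0"
proof -
  have N: "N u > 0" "N (c *\<^sub>R u) = \<bar>c\<bar> * N u" for c
    using assms by (auto simp: is_norm_def order.order_iff_strict)
  then have "N ((1 / N u) *\<^sub>R u) \<le> 1"
    by simp
  then have "u \<bullet> ((1 / N u) *\<^sub>R u) \<le> dual_norm N u"
    by (rule dual_norm_is_max(2)[OF assms(1)])
  moreover have "u \<bullet> ((1 / N u) *\<^sub>R u) > 0"
    using N(1) assms(2) by simp
  ultimately show ?thesis
    by linarith
qed

lemma residual_eq:
  assumes N: "is_norm N" and b: "snd b \<noteq> 0" and x: "fst x = 1"
  shows "residual N x b = \<bar>b \<bullet> x\<bar> / dual_norm N (snd b)"
proof (rule antisym)
  have scale: "N (c *\<^sub>R v) = \<bar>c\<bar> * N v" for c v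
    using N by (simp add: is_norm_def)
  have pos: "dual_norm N (snd b) > 0"
    using dual_norm_pos[OF N b] .
  have bx: "b \<bullet> x = snd b \<bullet> (snd x - y)" if "y \<in> hyperplane b" for y
    using that x by (simp add: hyperplane_def inner_prod_def inner_diff_right inner_commute)
  obtain v where v: "N v \<le> 1" "snd b \<bullet> v = dual_norm N (snd b)"
    using dual_norm_is_max(1)[OF N] by blast
  \<comment> \<open>The vector \<open>v\<close> attains the dual norm of \<open>snd b\<close>, so
    this multiple of it cancels \<open>b \<bullet> x\<close> exactly and lands on the
    hyperplane.\<close>
  define y where "y = snd x - (b \<bullet> x / dual_norm N (snd b)) *\<^sub>R v"
  have "y \<in> hyperplane b"
    using pos v x
    by (simp add: hyperplane_def inner_prod_def y_def inner_diff_left inner_diff_right inner_commute)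
  then have "residual N x b \<le> N (snd x - y)"
    by (rule residual_is_min(2)[OF N b])
  also have "\<dots> = \<bar>b \<bullet> x\<bar> / dual_norm N (snd b) * N v"
    using pos by (simp add: y_def scale)
  also have "\<dots> \<le> \<bar>b \<bullet> x\<bar> / dual_norm N (snd b)"
    using pos v by (intro mult_left_le) auto
  finally show "residual N x b \<le> \<bar>b \<bullet> x\<bar> / dual_norm N (snd b)" .
  obtain y' where y': "y' \<in> hyperplane b" "N (snd x - y') = residual N x b"
    using residual_is_min(1)[OF N b] by blast
  \<comment> \<open>Hoelder inequality for \<open>N\<close> and its dual, by rescaling
    \<open>u\<close> to unit length. Applied to \<open>snd x - y'\<close> and its negative, with
    \<open>y'\<close> a nearest point, it yields the lower bound with the absolute value.\<close>
  have le: "snd b \<bullet> u \<le> dual_norm N (snd b) * N u" for u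
  proof (cases "u = 0")
    case False
    then have "N u > 0"
      using N by (auto simp: is_norm_def order.order_iff_strict)
    then have "snd b \<bullet> ((1 / N u) *\<^sub>R u) \<le> dual_norm N (snd b)"
      by (intro dual_norm_is_max(2)[OF N]) (simp add: scale)
    with \<open>N u > 0\<close> show ?thesis
      by (simp add: field_simps)
  qed (use scale[of 0 0] in simp)
  have "\<bar>b \<bullet> x\<bar> \<le> dual_norm N (snd b) * residual N x b"
    using le[of "snd x - y'"] le[of "- (snd x - y')"] scale[of "-1" "snd x - y'"] bx[OF y'(1)] y'(2)
    by (simp only: inner_minus_right scaleR_minus1_left)
  then show "\<bar>b \<bullet> x\<bar> / dual_norm N (snd b) \<le> residual N x b"
    using pos by (simp add: field_simps)
qed

lemma residual_nonneg:
  assumes "is_norm N" and "snd b \<noteq> 0"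
  shows "0 \<le> residual N x b"
  using residual_is_min(1)[OF assms] assms(1) by (metis is_norm_def)

text \<open>Triangle inequality through a point of the hyperplane nearest to \<open>x'\<close>. The
  error term does not depend on \<open>b\<close>, so bounding one residual bounds all of them
  uniformly.\<close>

lemma residual_le_residual_plus:
  assumes "is_norm N" and "snd b \<noteq> 0"
  shows "residual N x b \<le> residual N x' b + N (snd x - snd x')"
proof -
  obtain y where y: "y \<in> hyperplane b" "N (snd x' - y) = residual N x' b"
    using residual_is_min(1)[OF assms] by blast
  have "residual N x b \<le> N (snd x - y)"
    by (rule residual_is_min(2)[OF assms y(1)])
  also have "snd x - y = (snd x' - y) + (snd x - snd x')"
    by simp
  also have "N \<dots> \<le> N (snd x' - y) + N (snd x - snd x')"
    using assms(1) unfolding is_norm_def by blast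
  finally show ?thesis
    using y(2) by simp
qed

section \<open>Order statistics, pigeonhole and permutation matrices\<close>

text \<open>Turns the j-th smallest value into the value at a concrete index \<open>f j\<close>; the
  permutation \<open>f\<close> later also supplies the matrix \<open>w\<close> of the lift.\<close>

lemma ex_sorting_bij:
  fixes a :: "nat \<Rightarrow> 'a::linorder"
  obtains f where "bij_betw f {1..n} {1..n}"
    and "\<And>i. i \<in> {1..n} \<Longrightarrow> sort (map a [1..<n + 1]) ! (i - 1) = a (f i)"
    and "\<And>i j. 1 \<le> i \<Longrightarrow> i \<le> j \<Longrightarrow> j \<le> n \<Longrightarrow> a (f i) \<le> a (f j)"
proof
  \<comment> \<open>Sorting the indices by their values, instead of the values, records where each
    value comes from. Lists count from 0, hence the shift to \<open>i - 1\<close>.\<close>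
  let ?ks = "sort_key a [1..<n + 1]"
  define f where "f i = ?ks ! (i - 1)" for i
  have "bij_betw (\<lambda>i. i - 1) {1..n} {..<n}"
    by (rule bij_betw_byWitness[where f' = Suc]) auto
  moreover have "bij_betw ((!) ?ks) {..<n} {1..n}"
    by (rule bij_betw_nth) auto
  ultimately show "bij_betw f {1..n} {1..n}"
    using bij_betw_trans[of "\<lambda>i. i - 1" "{1..n}" "{..<n}" "(!) ?ks"]
    by (simp add: f_def[abs_def] comp_def del: upt_Suc)
  have sorted: "sorted (map a ?ks)"
    by simp
  have "sort (map a [1..<n + 1]) = map a ?ks"
    by (rule properties_for_sort) (auto simp del: upt_Suc)
  then show "sort (map a [1..<n + 1]) ! (i - 1) = a (f i)" if "i \<in> {1..n}" for i
    using that nth_map[of "i - 1" ?ks a] by (auto simp: f_def simp del: upt_Suc)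
  show "a (f i) \<le> a (f j)" if "1 \<le> i" "i \<le> j" "j \<le> n" for i j
    using sorted_nth_mono[OF sorted, of "i - 1" "j - 1"] that
      nth_map[of "i - 1" ?ks a] nth_map[of "j - 1" ?ks a]
    by (auto simp: f_def simp del: upt_Suc nth_map)
qed

text \<open>The \<open>j\<close> indices \<open>h 1, ..., h j\<close> and the
  \<open>n - j + 1\<close> indices \<open>f j, ..., f n\<close> are together \<open>n + 1\<close>
  many, so \<open>h i = f k\<close> for some \<open>i \<le> j \<le> k\<close>. Then
  \<open>a (f j) \<le> a (f k) = a (h i) \<le> t i \<le> t j\<close>.\<close>

lemma sorted_le_of_inj:
  fixes a t :: "nat \<Rightarrow> 'a::linorder"
  assumes f: "bij_betw f {1..n} {1..n}"
    and a_mono: "\<And>i j. 1 \<le> i \<Longrightarrow> i \<le> j \<Longrightarrow> j \<le> n \<Longrightarrow> a (f i) \<le> a (f j)"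
    and h: "inj_on h {1..n}" "h ` {1..n} \<subseteq> {1..n}"
    and t: "\<And>j. j \<in> {1..n} \<Longrightarrow> a (h j) \<le> t j"
    and t_mono: "\<And>i j. 1 \<le> i \<Longrightarrow> i \<le> j \<Longrightarrow> j \<le> n \<Longrightarrow> t i \<le> t j"
    and j: "j \<in> {1..n}"
  shows "a (f j) \<le> t j"
proof -
  have "h ` {1..j} \<inter> f ` {j..n} \<noteq> {}"
  proof
    assume "h ` {1..j} \<inter> f ` {j..n} = {}"
    then have "card (h ` {1..j} \<union> f ` {j..n}) = card (h ` {1..j}) + card (f ` {j..n})"
      by (intro card_Un_disjoint) auto
    also have "card (h ` {1..j}) = j"
      using j by (subst card_image) (auto intro: inj_on_subset[OF h(1)])
    also have "card (f ` {j..n}) = Suc n - j"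
      using j by (subst card_image) (auto intro: inj_on_subset[OF bij_betw_imp_inj_on[OF f]])
    finally have "card (h ` {1..j} \<union> f ` {j..n}) = Suc n"
      using j by simp
    moreover have "h ` {1..j} \<subseteq> {1..n}" "f ` {j..n} \<subseteq> {1..n}"
      using h(2) bij_betwE[OF f] j by auto
    then have "card (h ` {1..j} \<union> f ` {j..n}) \<le> card {1..n}"
      by (intro card_mono) auto
    ultimately show False
      by simp
  qed
  then obtain i k where ik: "i \<in> {1..j}" "k \<in> {j..n}" "h i = f k"
    by blast
  have "a (f j) \<le> a (f k)"
    using ik j by (intro a_mono) auto
  also have "\<dots> \<le> t i"
    using t[of i] ik j by simp
  also have "\<dots> \<le> t j"
    using ik j by (intro t_mono) auto
  finally show ?thesis .
qed

text \<open>The column sums force a one into every column; choosing the same row for two columns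
  would push that row sum to at least 2.\<close>

lemma ex_inj_of_zero_one_matrix:
  fixes w :: "nat \<Rightarrow> nat \<Rightarrow> real"
  assumes w: "\<And>i j. i \<in> {1..n} \<Longrightarrow> j \<in> {1..n} \<Longrightarrow> w i j \<in> {0, 1}"
    and col: "\<And>j. j \<in> {1..n} \<Longrightarrow> (\<Sum>i=1..n. w i j) = 1"
    and row: "\<And>i. i \<in> {1..n} \<Longrightarrow> (\<Sum>j=1..n. w i j) = 1"
  obtains h where "inj_on h {1..n}" "h ` {1..n} \<subseteq> {1..n}"
    "\<And>j. j \<in> {1..n} \<Longrightarrow> w (h j) j = 1"
proof -
  have "\<exists>i\<in>{1..n}. w i j = 1" if "j \<in> {1..n}" for j
  proof (rule ccontr)
    assume "\<not> ?thesis"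
    then have "(\<Sum>i=1..n. w i j) = 0"
      using w that by (intro sum.neutral) blast
    then show False
      using col[OF that] by simp
  qed
  then obtain h where h: "\<And>j. j \<in> {1..n} \<Longrightarrow> h j \<in> {1..n} \<and> w (h j) j = 1"
    by metis
  have "inj_on h {1..n}"
  proof (rule inj_onI, rule ccontr)
    fix j k
    assume jk: "j \<in> {1..n}" "k \<in> {1..n}" "h j = h k" "j \<noteq> k"
    then have "(\<Sum>m\<in>{j, k}. w (h j) m) = 2"
      using h[of j] h[of k] by simp
    moreover have "0 \<le> w (h j) m" if "m \<in> {1..n}" for m
      using w[of "h j" m] h[OF jk(1)] that by auto
    then have "(\<Sum>m\<in>{j, k}. w (h j) m) \<le> (\<Sum>m=1..n. w (h j) m)"
      using jk by (intro sum_mono2) auto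
    ultimately show False
      using row[of "h j"] h[of j] jk by simp
  qed
  with h that show ?thesis
    by blast
qed

text \<open>Links the constraint on integer powers to the real exponent \<open>r / s\<close>. Zero
  is treated apart because \<open>powr_realpow\<close> needs a positive base.\<close>

lemma powr_rational_power:
  fixes a :: real
  assumes "0 \<le> a" "r > 0" "s > 0"
  shows "(a powr (real r / real s)) ^ s = a ^ r"
proof (cases "a = 0")
  case False
  then have "(a powr (real r / real s)) ^ s = a powr (real r / real s * real s)"
    by (simp add: powr_powr flip: powr_realpow)
  then show ?thesis
    using False assms by (simp add: powr_realpow)
qed (use assms in \<open>simp add: zero_power\<close>)

section \<open>From feasible points of the program to hyperplanes\<close>

text \<open>This direction holds for every \<open>M\<close>, as the big-M constraints are used only
  at entries where \<open>w\<close> is 1.\<close>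

lemma fitting_objective_le_mp_objective:
  assumes N: "is_norm N"
    and x: "\<And>i. i \<in> {1..n} \<Longrightarrow> fst (x i) = 1"
    and l: "\<And>i. i \<in> {1..n} \<Longrightarrow> 0 \<le> l i"
    and rs: "r > 0" "s > 0"
    and feas: "(b, e, z, t, w) \<in> mp_feasible N n x r s M"
  shows "fitting_objective N n x l (real r / real s) b \<le> mp_objective n l (b, e, z, t, w)"
proof -
  let ?p = "real r / real s"
  define a where "a i = residual N (x i) b" for i
  from feas have b: "snd b \<noteq> 0"
    and z: "\<And>i. i \<in> {1..n} \<Longrightarrow> 0 \<le> z i"
    and w: "\<And>i j. i \<in> {1..n} \<Longrightarrow> j \<in> {1..n} \<Longrightarrow> w i j \<in> {0, 1}"
    and e: "\<And>i. i \<in> {1..n} \<Longrightarrow> a i \<le> e i"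
    and zt: "\<And>i j. i \<in> {1..n} \<Longrightarrow> j \<in> {1..n} \<Longrightarrow> z i \<le> t j + M * (1 - w i j)"
    and ez: "\<And>i. i \<in> {1..n} \<Longrightarrow> e i ^ r \<le> z i ^ s"
    and col: "\<And>j. j \<in> {1..n} \<Longrightarrow> (\<Sum>i=1..n. w i j) = 1"
    and row: "\<And>i. i \<in> {1..n} \<Longrightarrow> (\<Sum>j=1..n. w i j) = 1"
    and t: "\<And>j. j \<in> {2..n} \<Longrightarrow> t (j - 1) \<le> t j"
    using x by (auto simp: mp_feasible_def a_def residual_eq[OF N])
  have a_nonneg: "0 \<le> a i" for i
    using residual_nonneg[OF N b] by (simp add: a_def)
  \<comment> \<open>Taking s-th roots; the rule expects an exponent of the form
    \<open>Suc _\<close>, hence \<open>s - 1\<close>.\<close>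
  have az: "a i powr ?p \<le> z i" if "i \<in> {1..n}" for i
  proof (rule power_le_imp_le_base[of _ "s - 1"])
    have "(a i powr ?p) ^ s \<le> e i ^ r"
      using powr_rational_power[OF a_nonneg rs] power_mono[OF e[OF that] a_nonneg] by simp
    also have "\<dots> \<le> z i ^ s"
      by (rule ez[OF that])
    finally show "(a i powr ?p) ^ Suc (s - 1) \<le> z i ^ Suc (s - 1)"
      using rs by simp
  qed (rule z[OF that])
  have t_mono: "t i \<le> t j" if "1 \<le> i" "i \<le> j" "j \<le> n" for i j
    using that(2,3,1)
  proof (induction j rule: dec_induct)
    case (step j)
    then show ?case
      using t[of "Suc j"] by simp
  qed simp
  obtain h where h: "inj_on h {1..n}" "h ` {1..n} \<subseteq> {1..n}"
    "\<And>j. j \<in> {1..n} \<Longrightarrow> w (h j) j = 1"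
    using ex_inj_of_zero_one_matrix[OF w col row] by metis
  obtain f where f: "bij_betw f {1..n} {1..n}"
    "\<And>i. i \<in> {1..n} \<Longrightarrow> sort (map a [1..<n + 1]) ! (i - 1) = a (f i)"
    "\<And>i j. 1 \<le> i \<Longrightarrow> i \<le> j \<Longrightarrow> j \<le> n \<Longrightarrow> a (f i) \<le> a (f j)"
    using ex_sorting_bij[of n a] by blast
  have "a (f j) powr ?p \<le> t j" if "j \<in> {1..n}" for j
  proof (rule sorted_le_of_inj[where a = "\<lambda>i. a i powr ?p", OF f(1) _ h(1,2) _ t_mono that])
    show "a (f i) powr ?p \<le> a (f j) powr ?p" if "1 \<le> i" "i \<le> j" "j \<le> n" for i j
      using f(3)[OF that] a_nonneg by (intro powr_mono2) auto
    \<comment> \<open>The big-M term vanishes in row \<open>h j\<close> of column \<open>j\<close>,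
      so \<open>a (h j) powr ?p \<le> z (h j) \<le> t j\<close>.\<close>
    show "a (h j) powr ?p \<le> t j" if "j \<in> {1..n}" for j
      using az[of "h j"] zt[of "h j" j] h(2) h(3)[OF that] that by fastforce
  qed auto
  moreover have "sorted_residual N n x b j = a (f j)" if "j \<in> {1..n}" for j
    using f(2)[OF that] by (simp only: sorted_residual_def a_def[abs_def])
  ultimately show ?thesis
    using l by (auto simp: fitting_objective_def mp_objective_def intro!: sum_mono mult_left_mono)
qed

section \<open>From hyperplanes to feasible points of the program\<close>

text \<open>The hypothesis \<open>t\<close> handles the entries where the permutation matrix is 1,
  the hypothesis \<open>M\<close> those where it is 0. Leaving \<open>t\<close> general covers both
  the sorted powers and the constant choice made when all weights vanish.\<close>

lemma mp_feasible_of_bij: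
  assumes N: "is_norm N"
    and x: "\<And>i. i \<in> {1..n} \<Longrightarrow> fst (x i) = 1"
    and rs: "r > 0" "s > 0"
    and b: "snd b \<noteq> 0"
    and f: "bij_betw f {1..n} {1..n}"
    and t: "\<And>j. j \<in> {1..n} \<Longrightarrow> residual N (x (f j)) b powr (real r / real s) \<le> t j"
    and t_mono: "\<And>j. j \<in> {2..n} \<Longrightarrow> t (j - 1) \<le> t j"
    and M: "\<And>i j. i \<in> {1..n} \<Longrightarrow> j \<in> {1..n} \<Longrightarrow>
      residual N (x i) b powr (real r / real s) \<le> t j + M"
  shows "(b, \<lambda>i. residual N (x i) b, \<lambda>i. residual N (x i) b powr (real r / real s), t,
    \<lambda>i j. if f j = i then 1 else 0) \<in> mp_feasible N n x r s M"
proof -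
  have "0 \<le> t j" if "j \<in> {1..n}" for j
    by (rule order_trans[OF _ t[OF that]]) simp
  moreover have "(\<Sum>i=1..n. if f j = i then 1 else 0 :: real) = 1" if "j \<in> {1..n}" for j
    using bij_betwE[OF f] that by (simp add: sum.delta)
  moreover have "(\<Sum>j=1..n. if f j = i then 1 else 0 :: real) = 1" if "i \<in> {1..n}" for i
    using sum.reindex_bij_betw[OF f, of "\<lambda>k. if k = i then 1 else 0 :: real"] that by simp
  ultimately show ?thesis
    using x b t t_mono M residual_nonneg[OF N b] rs
    by (auto simp: mp_feasible_def powr_rational_power simp flip: residual_eq[OF N b])
qed

lemma residual_bound_on_sublevel:
  assumes N: "is_norm N"
    and l: "\<And>i. i \<in> {1..n} \<Longrightarrow> 0 \<le> l i"
    and p: "p > 0"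
    and k: "k \<in> {1..n}" "l k > 0"
  shows "\<exists>B\<ge>0. \<forall>b. snd b \<noteq> 0 \<longrightarrow> fitting_objective N n x l p b \<le> C \<longrightarrow>
    (\<forall>i\<in>{1..n}. residual N (x i) b \<le> B)"
proof -
  \<comment> \<open>A crude bound on all pairwise distances: the sum of nonnegative terms dominates
    each of them.\<close>
  define D where "D = (\<Sum>i=1..n. \<Sum>j=1..n. N (snd (x i) - snd (x j)))"
  have N_nonneg: "0 \<le> N v" for v
    using N by (simp add: is_norm_def)
  have D: "N (snd (x i) - snd (x j)) \<le> D" if "i \<in> {1..n}" "j \<in> {1..n}" for i j
  proof -
    have "N (snd (x i) - snd (x j)) \<le> (\<Sum>j=1..n. N (snd (x i) - snd (x j)))"
      using that N_nonneg by (intro member_le_sum) auto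
    also have "\<dots> \<le> D"
      unfolding D_def using that N_nonneg
      by (intro member_le_sum[of _ _ "\<lambda>i. \<Sum>j=1..n. N (snd (x i) - snd (x j))"])
        (auto intro: sum_nonneg)
    finally show ?thesis .
  qed
  have "0 \<le> D"
    unfolding D_def by (intro sum_nonneg N_nonneg)
  \<comment> \<open>The first summand bounds the k-th smallest residual, since its p-th power times
    \<open>l k\<close> is at most the whole objective. Passing to any other demand point costs at
    most \<open>D\<close>.\<close>
  define B where "B = (C / l k) powr (1 / p) + D"
  have "residual N (x i) b \<le> B"
    if b: "snd b \<noteq> 0" and le: "fitting_objective N n x l p b \<le> C" and i: "i \<in> {1..n}" for b i
  proof -
    obtain f where f: "bij_betw f {1..n} {1..n}"
      "\<And>j. j \<in> {1..n} \<Longrightarrow> sorted_residual N n x b j = residual N (x (f j)) b"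
      unfolding sorted_residual_def
      using ex_sorting_bij[of n "\<lambda>i. residual N (x i) b"] by metis
    have fk: "f k \<in> {1..n}"
      using bij_betwE[OF f(1)] k by blast
    let ?a = "residual N (x (f k)) b"
    have "l k * ?a powr p \<le> fitting_objective N n x l p b"
      unfolding fitting_objective_def using k l f(2)[OF k(1)]
        member_le_sum[of k "{1..n}" "\<lambda>i. l i * sorted_residual N n x b i powr p"] by simp
    also note le
    finally have "?a powr p \<le> C / l k"
      using k by (simp add: field_simps)
    then have "(?a powr p) powr (1 / p) \<le> (C / l k) powr (1 / p)"
      using p by (intro powr_mono2) auto
    then have "?a \<le> (C / l k) powr (1 / p)"
      using p residual_nonneg[OF N b, of "x (f k)"] by (simp add: powr_powr)
    then show ?thesis
      using residual_le_residual_plus[OF N b, of "x i" "x (f k)"] D[OF i fk]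
      by (simp add: B_def)
  qed
  moreover have "0 \<le> B"
    using \<open>0 \<le> D\<close> by (simp add: B_def)
  ultimately show ?thesis
    by blast
qed

lemma ex_mp_lift:
  assumes N: "is_norm N"
    and x: "\<And>i. i \<in> {1..n} \<Longrightarrow> fst (x i) = 1"
    and l: "\<And>i. i \<in> {1..n} \<Longrightarrow> 0 \<le> l i"
    and rs: "r > 0" "s > 0"
  shows "\<exists>M0>0. \<forall>M\<ge>M0. \<forall>b. snd b \<noteq> 0 \<longrightarrow>
    fitting_objective N n x l (real r / real s) b \<le> C \<longrightarrow>
    (\<exists>y\<in>mp_feasible N n x r s M. fst y = b \<and>
      mp_objective n l y \<le> fitting_objective N n x l (real r / real s) b)"
proof (cases "\<exists>k\<in>{1..n}. l k > 0")
  case True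
  let ?p = "real r / real s"
  have "?p > 0"
    using rs by simp
  from True obtain k where k: "k \<in> {1..n}" "l k > 0"
    by blast
  obtain B where B: "B \<ge> 0" "\<And>b i. snd b \<noteq> 0 \<Longrightarrow>
      fitting_objective N n x l ?p b \<le> C \<Longrightarrow> i \<in> {1..n} \<Longrightarrow> residual N (x i) b \<le> B"
    using residual_bound_on_sublevel[where n = n and l = l and x = x and C = C,
      OF N l \<open>?p > 0\<close> k] by blast
  have "\<exists>y\<in>mp_feasible N n x r s M. fst y = b \<and>
      mp_objective n l y \<le> fitting_objective N n x l ?p b"
    if M: "M \<ge> B powr ?p + 1" and b: "snd b \<noteq> 0"
      and le: "fitting_objective N n x l ?p b \<le> C" for M b
  proof -
    define a where "a i = residual N (x i) b" for i
    obtain f where f: "bij_betw f {1..n} {1..n}"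
      "\<And>j. j \<in> {1..n} \<Longrightarrow> sort (map a [1..<n + 1]) ! (j - 1) = a (f j)"
      "\<And>i j. 1 \<le> i \<Longrightarrow> i \<le> j \<Longrightarrow> j \<le> n \<Longrightarrow> a (f i) \<le> a (f j)"
      using ex_sorting_bij[of n a] by blast
    have a_nonneg: "0 \<le> a i" for i
      using residual_nonneg[OF N b] by (simp add: a_def)
    have aM: "a i powr ?p \<le> M" if "i \<in> {1..n}" for i
      using powr_mono2[OF _ a_nonneg, of ?p i B] B(2)[OF b le that] M rs by (simp add: a_def)
    have "a (f (j - 1)) powr ?p \<le> a (f j) powr ?p" if "j \<in> {2..n}" for j
      using f(3)[of "j - 1" j] that a_nonneg by (intro powr_mono2) auto
    moreover have "a i powr ?p \<le> a (f j) powr ?p + M" if "i \<in> {1..n}" for i j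
      using aM[OF that] powr_ge_zero[of "a (f j)" ?p] by linarith
    ultimately have "(b, a, \<lambda>i. a i powr ?p, \<lambda>j. a (f j) powr ?p, \<lambda>i j. if f j = i then 1 else 0)
        \<in> mp_feasible N n x r s M"
      unfolding a_def[abs_def] by (intro mp_feasible_of_bij[OF N x rs b f(1)]) simp_all
    moreover have "sorted_residual N n x b j = a (f j)" if "j \<in> {1..n}" for j
      using f(2)[OF that] by (simp only: sorted_residual_def a_def[abs_def])
    then have "mp_objective n l
        (b, a, \<lambda>i. a i powr ?p, \<lambda>j. a (f j) powr ?p, \<lambda>i j. if f j = i then 1 else 0)
        = fitting_objective N n x l ?p b"
      by (simp add: mp_objective_def fitting_objective_def)
    ultimately show ?thesis
      by - (rule bexI[rotated], assumption, simp)
  qed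
  \<comment> \<open>\<open>B powr ?p\<close> dominates all powered residuals on the sublevel set;
    adding 1 keeps the threshold positive even if \<open>B = 0\<close>.\<close>
  moreover have "B powr ?p + 1 > 0"
    using powr_ge_zero[of B ?p] by linarith
  ultimately show ?thesis
    by blast
next
  case False
  let ?p = "real r / real s"
  have l0: "l i = 0" if "i \<in> {1..n}" for i
    using False l that by force
  have "\<exists>y\<in>mp_feasible N n x r s M. fst y = b \<and>
      mp_objective n l y \<le> fitting_objective N n x l ?p b"
    if M: "M \<ge> 1" and b: "snd b \<noteq> 0" for M b
  proof -
    \<comment> \<open>With all weights zero the objective gives no control over the residuals. The
      constant \<open>S\<close> may depend on \<open>b\<close> at no cost and dominates every
      powered residual, so the identity permutation serves as assignment.\<close>
    define S where "S = (\<Sum>i=1..n. residual N (x i) b powr ?p)"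
    have S: "residual N (x i) b powr ?p \<le> S" if "i \<in> {1..n}" for i
      unfolding S_def using that
      by (intro member_le_sum[of _ _ "\<lambda>i. residual N (x i) b powr ?p"]) auto
    have "(b, \<lambda>i. residual N (x i) b, \<lambda>i. residual N (x i) b powr ?p, \<lambda>j. S,
        \<lambda>i j. if id j = i then 1 else 0) \<in> mp_feasible N n x r s M"
    proof (rule mp_feasible_of_bij[OF N x rs b bij_betw_id])
      show "residual N (x i) b powr ?p \<le> S + M" if "i \<in> {1..n}" for i
        using S[OF that] M by simp
    qed (use S in simp_all)
    then show ?thesis
      by (rule bexI[rotated]) (simp add: mp_objective_def fitting_objective_def l0)
  qed
  then show ?thesis
    by (intro exI[of _ 1]) auto
qed

section \<open>Equivalence for all large constants\<close>

theorem theorem5: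
  fixes N :: "real ^ 'd \<Rightarrow> real"
    and n r s :: nat
    and x :: "nat \<Rightarrow> real \<times> (real ^ 'd)"
    and l :: "nat \<Rightarrow> real"
    and p :: real
  assumes "is_norm N"
    and "\<And>i. i \<in> {1..n} \<Longrightarrow> fst (x i) = 1"
    and "\<And>i. i \<in> {1..n} \<Longrightarrow> 0 \<le> l i"
    and "r > 0" and "s > 0" and "p = real r / real s"
  shows "\<exists>M0>0. \<forall>M\<ge>M0.
    equivalent_problems
      fitting_feasible (fitting_objective N n x l p)
      (mp_feasible N n x r s M) (mp_objective n l) fst"
proof -
  obtain u :: "real ^ 'd" where "u \<noteq> 0"
    using nonzero_Basis nonempty_Basis by blast
  \<comment> \<open>An arbitrary admissible hyperplane; its objective value is the level that
    determines \<open>M0\<close>.\<close>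
  define b0 :: "real \<times> (real ^ 'd)" where "b0 = (0, u)"
  obtain M0 where M0: "M0 > 0" "\<And>M b. M \<ge> M0 \<Longrightarrow> snd b \<noteq> 0 \<Longrightarrow>
      fitting_objective N n x l p b \<le> fitting_objective N n x l p b0 \<Longrightarrow>
      \<exists>y\<in>mp_feasible N n x r s M. fst y = b \<and> mp_objective n l y \<le> fitting_objective N n x l p b"
    using ex_mp_lift[where n = n and x = x and l = l and C = "fitting_objective N n x l p b0",
      OF assms(1-5), folded assms(6)] by blast
  have "equivalent_problems fitting_feasible (fitting_objective N n x l p)
      (mp_feasible N n x r s M) (mp_objective n l) fst" if "M \<ge> M0" for M
  proof (rule equivalent_problemsI)
    show "fst y \<in> fitting_feasible \<and>
        fitting_objective N n x l p (fst y) \<le> mp_objective n l y"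
      if "y \<in> mp_feasible N n x r s M" for y
    proof (cases y)
      case (fields b e z t w)
      then have "snd b \<noteq> 0"
        using that by (simp add: mp_feasible_def)
      then show ?thesis
        using fitting_objective_le_mp_objective[where n = n and x = x and l = l,
            OF assms(1-5), folded assms(6)] that
        by (simp add: fields fitting_feasible_def)
    qed
    show "b0 \<in> fitting_feasible"
      using \<open>u \<noteq> 0\<close> by (simp add: b0_def fitting_feasible_def)
  qed (use M0(2)[OF that] in \<open>simp add: fitting_feasible_def\<close>)
  with M0(1) show ?thesis
    by blast
qed

end
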